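(* The zero forcing number of the generalized gear graph $Gr(m,r)$ is $\mathrm{Z}\big(Gr(m,r)\big) = 3$.
   Context: The generalized gear graph, denoted $Gr(m,r)$, is the (undirected) graph with vertex set $\{v_i\}_{i=0}^{m(r+1)}$ such that for distinct vertices $v_i, v_j$, the edge $v_iv_j$ is present if and only if (for some ordering of the two indices) one of the following is true: (1) $i=0$ and $(r+1) \mid j$; (2) $i,j \neq 0$ and $|i-j|=1$; (3) $\{i,j\} = \{1, m(r+1)\}$. The definition is given with no explicit range for the parameters $m$ and $r$. In the special case $r=1$ this is the traditional gear graph. Zero forcing: each vertex of a graph $G$ is initially colored blue or white. Color change rule: if $u$ is blue and $v$ is the only white neighbor of $u$, then $u$ can force $v$ to become blue; blue vertices stay blue. A set $B \subseteq V(G)$ is a zero forcing set of $G$ if, starting with exactly the vertices of $B$ blue, repeated application of the rule eventually makes every vertex of $G$ blue. The zero forcing number $\mathrm{Z}(G)$ is the minimum cardinality among the zero forcing sets of $G$.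
   Formalization: The claim is proved for m ≥ 2 with m(r+1) ≥ 3; no range of m and r is stated, and for every other pair it is false: Z = 1 for m = 0, Z ≤ 2 for m = 1 (cycle with a pendant hub, or a path), and Z = 2 for (m,r) = (2,0), a triangle. *)

theory Defs
  imports "Graph_Theory.Pair_Digraph"
begin

text \<open>Undirected simple graphs are represented as in \<^theory>\<open>Graph_Theory.Pair_Digraph\<close> (locale
  \<^locale>\<open>pair_graph\<close>): an edge \<open>uv\<close> is the pair of arcs \<open>(u, v)\<close> and \<open>(v, u)\<close>.\<close>

definition gear_adj :: "nat \<Rightarrow> nat \<Rightarrow> nat \<Rightarrow> nat \<Rightarrow> bool" where
  "gear_adj m r i j \<longleftrightarrow>
     i = 0 \<and> (r + 1) dvd j \<or>
     i \<noteq> 0 \<and> j \<noteq> 0 \<and> \<bar>int i - int j\<bar> = 1 \<or>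
     {i, j} = {1, m * (r + 1)}"

text \<open>The vertex \<open>v\<^sub>i\<close> is represented by its index \<open>i\<close>; \<open>0\<close> is the hub.\<close>

definition gear_graph :: "nat \<Rightarrow> nat \<Rightarrow> nat pair_pre_digraph" where
  "gear_graph m r = \<lparr>
     pverts = {0..m * (r + 1)},
     parcs = {(i, j). i \<in> {0..m * (r + 1)} \<and> j \<in> {0..m * (r + 1)} \<and> i \<noteq> j \<and>
                      (gear_adj m r i j \<or> gear_adj m r j i)} \<rparr>"

lemma pair_graph_gear_graph: "pair_graph (gear_graph m r)"
proof
  have "parcs (gear_graph m r) \<subseteq> {0..m * (r + 1)} \<times> {0..m * (r + 1)}"
    by (auto simp: gear_graph_def)
  then show "finite (parcs (gear_graph m r))"
    by (rule finite_subset) simp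
  show "symmetric (with_proj (gear_graph m r))"
    by (auto simp: symmetric_def gear_graph_def intro!: symI)
qed (auto simp: gear_graph_def)

text \<open>\<open>color_change G S T\<close>: if \<open>S\<close> is the set of blue vertices, one application of the color change
  rule can lead to the set \<open>T\<close> of blue vertices.\<close>

inductive color_change :: "'a pair_pre_digraph \<Rightarrow> 'a set \<Rightarrow> 'a set \<Rightarrow> bool"
  for G :: "'a pair_pre_digraph" where
  force: "u \<in> S \<Longrightarrow> {w. (u, w) \<in> parcs G \<and> w \<notin> S} = {v} \<Longrightarrow> color_change G S (insert v S)"

definition zero_forcing_set :: "'a pair_pre_digraph \<Rightarrow> 'a set \<Rightarrow> bool" where
  "zero_forcing_set G B \<longleftrightarrow> B \<subseteq> pverts G \<and> (color_change G)\<^sup>*\<^sup>* B (pverts G)"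

text \<open>Meant for finite graphs, which have \<^term>\<open>pverts G\<close> itself as a zero forcing set.\<close>

definition zero_forcing_number :: "'a pair_pre_digraph \<Rightarrow> nat" where
  "zero_forcing_number G = (LEAST k. \<exists>B. zero_forcing_set G B \<and> card B = k)"

end

theory Submission
  imports Defs
begin

text \<open>Upper bound: if the hub and two consecutive rim vertices are blue, the forcing runs once
  around the rim. Lower bound: a proper vertex set in which no vertex has exactly one neighbour
  outside can never be left by the color change rule, and every pair of vertices lies in such a
  set. For a non-adjacent pair take the pair itself, since all degrees are at least 2; for two
  adjacent rim vertices take the closed rim segment between consecutive spokes that contains them;
  for the hub and a spoke end take the pair if \<open>m \<ge> 3\<close>, and the hub with both spoke ends if
  \<open>m = 2\<close>.\<close>

section \<open>Vertex sets that the color change rule cannot leave\<close>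

text \<open>The vertices of a graph outside \<open>C\<close>, if there are any, form what is known
  as a fort: each vertex of \<open>C\<close> is adjacent to none or to at least two of them.\<close>

definition stalled :: "'a pair_pre_digraph \<Rightarrow> 'a set \<Rightarrow> bool" where
  "stalled G C \<longleftrightarrow> (\<forall>u\<in>C. \<forall>v. {w. (u, w) \<in> parcs G \<and> w \<notin> C} \<noteq> {v})"

lemma stalledI:
  assumes "\<And>u. u \<in> C \<Longrightarrow> (\<forall>w. (u, w) \<in> parcs G \<longrightarrow> w \<in> C) \<or>
    (\<exists>x y. x \<noteq> y \<and> (u, x) \<in> parcs G \<and> (u, y) \<in> parcs G \<and> x \<notin> C \<and> y \<notin> C)"
  shows "stalled G C"
  unfolding stalled_def
proof (intro ballI allI notI)
  fix u v
  assume "u \<in> C" and eq: "{w. (u, w) \<in> parcs G \<and> w \<notin> C} = {v}"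
  have eq': "w = v" if "(u, w) \<in> parcs G" "w \<notin> C" for w
    using that eq by blast
  from eq have "(u, v) \<in> parcs G" "v \<notin> C"
    by blast+
  with assms[OF \<open>u \<in> C\<close>] eq' show False
    by metis
qed

text \<open>If \<open>u\<close> forces \<open>v\<close> while the blue set \<open>S\<close> lies in
  \<open>C\<close>, the neighbours of \<open>u\<close> outside \<open>C\<close> are among its white
  ones. So a \<open>v\<close> outside \<open>C\<close> would be the only neighbour of
  \<open>u\<close> there.\<close>

lemma stalled_color_change:
  assumes "stalled G C" and "(color_change G)\<^sup>*\<^sup>* B T" and "B \<subseteq> C"
  shows "T \<subseteq> C"
  using assms(2,3)
proof (induction rule: rtranclp_induct)
  case (step S T)
  then have "S \<subseteq> C"
    by simp
  from step.hyps(2) show ?case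
  proof cases
    case (force u v)
    have "{w. (u, w) \<in> parcs G \<and> w \<notin> C} \<noteq> {v}"
      using assms(1) force \<open>S \<subseteq> C\<close> unfolding stalled_def by blast
    then have "v \<in> C"
      using force \<open>S \<subseteq> C\<close> by blast
    then show ?thesis
      using force \<open>S \<subseteq> C\<close> by blast
  qed
qed simp

lemma stalled_not_zero_forcing:
  assumes "stalled G C" and "B \<subseteq> C" and "x \<in> pverts G" and "x \<notin> C"
  shows "\<not> zero_forcing_set G B"
  using stalled_color_change[OF assms(1) _ assms(2)] assms(3,4)
  unfolding zero_forcing_set_def by blast

lemma zero_forcing_number_eqI:
  assumes "zero_forcing_set G B"
    and "\<And>B'. zero_forcing_set G B' \<Longrightarrow> card B \<le> card B'"
  shows "zero_forcing_number G = card B"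
  unfolding zero_forcing_number_def by (rule Least_equality) (use assms in auto)

section \<open>Parameters and adjacency of the gear graph\<close>

text \<open>\<open>s\<close> is the rim distance between consecutive spokes and \<open>n\<close> the
  rim length. \<open>m_ge\<close> gives the hub two neighbours; \<open>n_ge\<close> makes the rim a
  genuine cycle.\<close>

locale gear =
  fixes m r s n :: nat
  assumes s_eq: "s = r + 1" and n_eq: "n = m * s" and m_ge: "m \<ge> 2" and n_ge: "n \<ge> 3"
begin

abbreviation "G \<equiv> gear_graph m r"

abbreviation "next_rim i \<equiv> if i = n then 1 else i + 1"

abbreviation "prev_rim i \<equiv> if i = 1 then n else i - 1"

lemma s_pos: "s > 0"
  by (simp add: s_eq)

lemma s_dvd_n: "s dvd n"
  by (simp add: n_eq)

lemma two_s_le_n: "2 * s \<le> n"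
  unfolding n_eq using m_ge by (rule mult_le_mono1)

lemma pverts_gear: "pverts G = {0..n}"
  by (simp add: gear_graph_def n_eq s_eq)

lemma parcs_gear_iff:
  "(i, j) \<in> parcs G \<longleftrightarrow> i \<le> n \<and> j \<le> n \<and> i \<noteq> j \<and>
    (i = 0 \<and> s dvd j \<or> j = 0 \<and> s dvd i \<or>
     i \<noteq> 0 \<and> j \<noteq> 0 \<and> (j = i + 1 \<or> i = j + 1 \<or> i = 1 \<and> j = n \<or> i = n \<and> j = 1))"
proof -
  have "\<bar>int i - int j\<bar> = 1 \<longleftrightarrow> j = i + 1 \<or> i = j + 1" for i j
    by linarith
  then show ?thesis
    unfolding gear_graph_def gear_adj_def s_eq[symmetric] n_eq[symmetric]
    using n_ge by (auto simp: doubleton_eq_iff)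
qed

lemma hub_arc_iff: "(0, j) \<in> parcs G \<longleftrightarrow> 0 < j \<and> j \<le> n \<and> s dvd j"
  by (auto simp: parcs_gear_iff)

lemma rim_arc_iff:
  assumes "1 \<le> i" and "i \<le> n"
  shows "(i, j) \<in> parcs G \<longleftrightarrow> j = next_rim i \<or> j = prev_rim i \<or> j = 0 \<and> s dvd i"
  using assms n_ge unfolding parcs_gear_iff by auto

section \<open>Upper bound by forcing around the rim\<close>

lemma gear_zero_forcing_set: "zero_forcing_set G {0, 1, n}"
proof -
  have "(color_change G)\<^sup>*\<^sup>* {0, 1, n} ({0..k} \<union> {n})" if "1 \<le> k" "k < n" for k
    using that
  proof (induction k rule: dec_induct)
    case base
    have "{0..1} \<union> {n} = {0, 1, n}"
      by auto
    then show ?case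
      by simp
  next
    case (step k)
    \<comment> \<open>The hub is already blue in case \<open>k\<close> is a spoke end, and the rim
      neighbour behind \<open>k\<close> is \<open>k - 1\<close>, or \<open>n\<close> if
      \<open>k = 1\<close>. The induction premise \<open>Suc k < n\<close> makes
      \<open>Suc k\<close> white.\<close>
    have "{w. (k, w) \<in> parcs G \<and> w \<notin> {0..k} \<union> {n}} = {Suc k}"
      using step rim_arc_iff[of k] by auto
    then have "color_change G ({0..k} \<union> {n}) (insert (Suc k) ({0..k} \<union> {n}))"
      by (intro color_change.force[of k]) auto
    moreover have "insert (Suc k) ({0..k} \<union> {n}) = {0..Suc k} \<union> {n}"
      by auto
    ultimately show ?case
      using step by (simp add: rtranclp.rtrancl_into_rtrancl)
  qed
  from this[of "n - 1"] have "(color_change G)\<^sup>*\<^sup>* {0, 1, n} ({0..n - 1} \<union> {n})"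
    using n_ge by simp
  moreover have "{0..n - 1} \<union> {n} = {0..n}"
    using n_ge by auto
  ultimately show ?thesis
    using n_ge by (simp add: zero_forcing_set_def pverts_gear)
qed

section \<open>Minimum degree two and stalled sets of the gear graph\<close>

lemma rim_two_neighbours:
  assumes "1 \<le> u" and "u \<le> n"
  shows "next_rim u \<noteq> prev_rim u \<and> (u, next_rim u) \<in> parcs G \<and> (u, prev_rim u) \<in> parcs G"
  using assms n_ge by (auto simp: rim_arc_iff)

lemma gear_two_neighbours:
  assumes "u \<le> n"
  shows "\<exists>x y. x \<noteq> y \<and> (u, x) \<in> parcs G \<and> (u, y) \<in> parcs G"
proof (cases "u = 0")
  case True
  have "s \<noteq> 2 * s" "(0, s) \<in> parcs G" "(0, 2 * s) \<in> parcs G"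
    using s_pos two_s_le_n by (simp_all add: hub_arc_iff)
  with True show ?thesis
    by blast
next
  case False
  then have "1 \<le> u"
    by simp
  with assms rim_two_neighbours[of u] show ?thesis
    by blast
qed

lemma stalled_nonadjacent:
  assumes "a \<le> n" and "b \<le> n" and "(a, b) \<notin> parcs G"
  shows "stalled G {a, b}"
proof (rule stalledI)
  fix u
  assume u: "u \<in> {a, b}"
  then obtain x y where xy: "x \<noteq> y" "(u, x) \<in> parcs G" "(u, y) \<in> parcs G"
    using gear_two_neighbours[of u] assms(1,2) by blast
  have "(b, a) \<notin> parcs G" "(a, a) \<notin> parcs G" "(b, b) \<notin> parcs G"
    using assms(3) by (auto simp: gear_graph_def)
  then have "w \<notin> {a, b}" if "(u, w) \<in> parcs G" for w
    using that u assms(3) by blast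
  with xy show "(\<forall>w. (u, w) \<in> parcs G \<longrightarrow> w \<in> {a, b}) \<or>
    (\<exists>x y. x \<noteq> y \<and> (u, x) \<in> parcs G \<and> (u, y) \<in> parcs G \<and> x \<notin> {a, b} \<and> y \<notin> {a, b})"
    by blast
qed

text \<open>This is the rim segment from spoke end \<open>n\<close> across the wrap-around to spoke
  end \<open>s\<close>. Its inner vertices carry no spoke; each end has the hub and one rim vertex
  outside. \<open>n \<ge> 3\<close> keeps \<open>n - 1\<close> and \<open>s + 1\<close> outside even
  for \<open>s = 1\<close>.\<close>

lemma stalled_first_segment: "stalled G (insert n {1..s})"
proof (rule stalledI)
  let ?C = "insert n {1..s}"
  fix u
  assume "u \<in> ?C"
  then consider "u = n" | "u = s" | "1 \<le> u" "u < s"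
    by force
  then show "(\<forall>w. (u, w) \<in> parcs G \<longrightarrow> w \<in> ?C) \<or>
    (\<exists>x y. x \<noteq> y \<and> (u, x) \<in> parcs G \<and> (u, y) \<in> parcs G \<and> x \<notin> ?C \<and> y \<notin> ?C)"
  proof cases
    case 1
    then show ?thesis
      using two_s_le_n s_dvd_n n_ge
      by (intro disjI2 exI[of _ 0] exI[of _ "n - 1"]) (auto simp: rim_arc_iff)
  next
    case 2
    then show ?thesis
      using two_s_le_n s_pos n_ge
      by (intro disjI2 exI[of _ 0] exI[of _ "s + 1"]) (auto simp: rim_arc_iff)
  next
    case 3
    then have "\<not> s dvd u"
      using nat_dvd_not_less by auto
    with 3 show ?thesis
      using two_s_le_n by (intro disjI1) (auto simp: rim_arc_iff)
  qed
qed

lemma stalled_segment: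
  assumes "s dvd l" and "1 \<le> l" and "l + s \<le> n"
  shows "stalled G {l..l + s}"
proof (rule stalledI)
  let ?C = "{l..l + s}"
  have l: "s \<le> l"
    using assms(1,2) by (intro dvd_imp_le) auto
  have dvd: "s dvd l + s"
    using assms(1) by simp
  fix u
  assume "u \<in> ?C"
  then consider "u = l" | "u = l + s" | "l < u" "u < l + s"
    by force
  then show "(\<forall>w. (u, w) \<in> parcs G \<longrightarrow> w \<in> ?C) \<or>
    (\<exists>x y. x \<noteq> y \<and> (u, x) \<in> parcs G \<and> (u, y) \<in> parcs G \<and> x \<notin> ?C \<and> y \<notin> ?C)"
  proof cases
    case 1
    \<comment> \<open>The wrap to \<open>n\<close> happens only for \<open>l = 1\<close>, hence
      \<open>s = 1\<close>; the segment is then \<open>{1..2}\<close>, and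
      \<open>n \<ge> 3\<close>.\<close>
    have "prev_rim l \<notin> ?C" "prev_rim l \<noteq> 0"
      using l s_pos assms(2,3) n_ge by auto
    then show ?thesis
      using 1 assms rim_arc_iff[of l] by (intro disjI2 exI[of _ 0] exI[of _ "prev_rim l"]) auto
  next
    case 2
    \<comment> \<open>If \<open>l + s = n\<close> this is \<open>1\<close>, which lies in the
      segment only for \<open>l = s = 1\<close>, that is \<open>n = 2\<close>.\<close>
    have "next_rim (l + s) \<notin> ?C" "next_rim (l + s) \<noteq> 0"
      using l s_pos assms(2,3) n_ge by auto
    then show ?thesis
      using 2 assms dvd rim_arc_iff[of "l + s"]
      by (intro disjI2 exI[of _ 0] exI[of _ "next_rim (l + s)"]) auto
  next
    case 3
    have "\<not> s dvd u"
    proof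
      assume "s dvd u"
      \<comment> \<open>\<open>u - l\<close> would be a positive multiple of \<open>s\<close> below
        \<open>s\<close>.\<close>
      then have "s dvd u - l"
        using assms(1) by (rule dvd_diff_nat)
      then show False
        using 3 nat_dvd_not_less[of "u - l" s] by auto
    qed
    with 3 show ?thesis
      using assms(2,3) rim_arc_iff[of u] by (intro disjI1) auto
  qed
qed

section \<open>Pairs of vertices inside proper stalled sets\<close>

text \<open>For \<open>m = 2\<close> the hub has only one neighbour besides \<open>b\<close>, so
  \<open>{0, b}\<close> is not stalled and the other spoke end must be added.\<close>

lemma hub_spoke_in_stalled:
  assumes "(0, b) \<in> parcs G"
  obtains C where "stalled G C" and "{0, b} \<subseteq> C" and "\<exists>x\<le>n. x \<notin> C"
proof -
  have b: "1 \<le> b" "b \<le> n"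
    using assms by (auto simp: hub_arc_iff)
  consider "m = 2" | "m \<ge> 3"
    using m_ge by linarith
  then show ?thesis
  proof cases
    case 1
    then have n: "n = 2 * s"
      by (simp add: n_eq)
    \<comment> \<open>This makes the two spoke ends non-adjacent, so both rim neighbours of each lie
      outside the set.\<close>
    then have "s \<ge> 2"
      using n_ge by linarith
    have hub: "w \<in> {0, s, n}" if "(0, w) \<in> parcs G" for w
    proof -
      have "s dvd w"
        using that by (simp add: hub_arc_iff)
      then obtain q where q: "w = s * q" ..
      have "0 < s * q" "s * q \<le> s * 2"
        using that q n by (auto simp: hub_arc_iff)
      then have "q = 1 \<or> q = 2"
        by auto
      then show ?thesis
        using q n by auto
    qed
    have "stalled G {0, s, n}"
    proof (rule stalledI)
      fix u
      assume "u \<in> {0, s, n}"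
      then consider "u = 0" | "u = s" | "u = n"
        by blast
      then show "(\<forall>w. (u, w) \<in> parcs G \<longrightarrow> w \<in> {0, s, n}) \<or>
        (\<exists>x y. x \<noteq> y \<and> (u, x) \<in> parcs G \<and> (u, y) \<in> parcs G \<and> x \<notin> {0, s, n} \<and> y \<notin> {0, s, n})"
      proof cases
        case 1
        then show ?thesis
          using hub by blast
      next
        case 2
        then show ?thesis
          using n \<open>s \<ge> 2\<close> rim_arc_iff[of s]
          by (intro disjI2 exI[of _ "s - 1"] exI[of _ "s + 1"]) auto
      next
        case 3
        then show ?thesis
          using n \<open>s \<ge> 2\<close> rim_arc_iff[of n]
          by (intro disjI2 exI[of _ 1] exI[of _ "n - 1"]) auto
      qed
    qed
    moreover have "1 \<le> n" "1 \<notin> {0, s, n}"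
      using n \<open>s \<ge> 2\<close> by auto
    ultimately show ?thesis
      using that[of "{0, s, n}"] hub[OF assms] by blast
  next
    case 2
    have n: "3 * s \<le> n"
      unfolding n_eq using 2 by (rule mult_le_mono1)
    \<comment> \<open>Three distinct neighbours of the hub: at least two remain when
      \<open>b\<close> is removed.\<close>
    have multiples: "(0, s) \<in> parcs G" "(0, 2 * s) \<in> parcs G" "(0, n) \<in> parcs G"
      using n s_pos s_dvd_n n_ge by (auto simp: hub_arc_iff)
    have distinct: "s \<noteq> n" "2 * s \<noteq> n" "s \<noteq> 2 * s" "n \<noteq> 0" "s \<noteq> 0"
      using n s_pos n_ge by auto
    have "stalled G {0, b}"
    proof (rule stalledI)
      fix u
      assume "u \<in> {0, b}"
      then consider "u = 0" | "u = b"
        by blast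
      then show "(\<forall>w. (u, w) \<in> parcs G \<longrightarrow> w \<in> {0, b}) \<or>
        (\<exists>x y. x \<noteq> y \<and> (u, x) \<in> parcs G \<and> (u, y) \<in> parcs G \<and> x \<notin> {0, b} \<and> y \<notin> {0, b})"
      proof cases
        case 1
        have "\<exists>x y. x \<noteq> y \<and> x \<in> {s, 2 * s, n} \<and> y \<in> {s, 2 * s, n} \<and> x \<notin> {0, b} \<and> y \<notin> {0, b}"
        proof -
          consider "b = s" | "b = n" | "b \<noteq> s" "b \<noteq> n"
            by blast
          then show ?thesis
          proof cases
            case 1
            then show ?thesis
              using distinct by (intro exI[of _ "2 * s"] exI[of _ n]) auto
          next
            case 2
            then show ?thesis
              using distinct by (intro exI[of _ s] exI[of _ "2 * s"]) auto
          next
            case 3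
            then show ?thesis
              using distinct by (intro exI[of _ s] exI[of _ n]) auto
          qed
        qed
        then show ?thesis
          using 1 multiples by blast
      next
        case 2
        then show ?thesis
          using b n_ge rim_two_neighbours[of b]
          by (intro disjI2 exI[of _ "next_rim b"] exI[of _ "prev_rim b"]) auto
      qed
    qed
    moreover have "(if b = 1 then 2 else 1) \<le> n" "(if b = 1 then 2 else 1) \<notin> {0, b}"
      using n_ge by auto
    ultimately show ?thesis
      using that by blast
  qed
qed

lemma rim_pair_in_stalled:
  assumes "1 \<le> a" and "a < n"
  obtains C where "stalled G C" and "{a, a + 1} \<subseteq> C" and "\<exists>x\<le>n. x \<notin> C"
proof -
  \<comment> \<open>The last multiple of \<open>s\<close> not above \<open>a\<close>; the strict
    \<open>a < l + s\<close> puts \<open>a + 1\<close> into the same segment.\<close>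
  define l where "l = a div s * s"
  have a: "l \<le> a" "a < l + s"
    using div_mult_mod_eq[of a s] mod_less_divisor[OF s_pos, of a] unfolding l_def by linarith+
  show ?thesis
  \<comment> \<open>Index \<open>0\<close> is the hub and not a spoke end, so here the segment
    starts at \<open>n\<close> instead.\<close>
  proof (cases "l = 0")
    case True
    then show ?thesis
      using that[OF stalled_first_segment] a assms by auto
  next
    case False
    have "a div s < m"
      using assms(2) unfolding n_eq by (rule less_mult_imp_div_less)
    then have "(a div s + 1) * s \<le> m * s"
      by (intro mult_le_mono1) simp
    then have "l + s \<le> n"
      by (simp add: l_def n_eq)
    moreover have "s dvd l"
      by (simp add: l_def)
    moreover have "0 \<notin> {l..l + s}"
      using False by simp
    moreover have "{a, a + 1} \<subseteq> {l..l + s}"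
      using a by auto
    ultimately show ?thesis
      using that[OF stalled_segment[of l]] False by auto
  qed
qed

lemma pair_in_stalled:
  assumes "a < b" and "b \<le> n"
  obtains C where "stalled G C" and "{a, b} \<subseteq> C" and "\<exists>x\<le>n. x \<notin> C"
proof -
  consider "(a, b) \<notin> parcs G" | "(a, b) \<in> parcs G" "a = 0" | "(a, b) \<in> parcs G" "a \<noteq> 0"
    by blast
  then show ?thesis
  proof cases
    case 1
    have "card {a, b} < card {0..n}"
      using n_ge assms(1) by simp
    then have "\<not> {0..n} \<subseteq> {a, b}"
      using card_mono[of "{a, b}" "{0..n}"] by auto
    then have "\<exists>x\<le>n. x \<notin> {a, b}"
      by auto
    then show ?thesis
      using that[OF stalled_nonadjacent[OF _ assms(2) 1]] assms by simp
  next
    case 2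
    then show ?thesis
      using hub_spoke_in_stalled[of b] that by metis
  next
    case 3
    \<comment> \<open>The ordering \<open>a < b\<close> leaves the forward rim edges and the closing
      edge, which lies in the first segment.\<close>
    then have "b = a + 1 \<or> a = 1 \<and> b = n"
      using assms(1) by (auto simp: parcs_gear_iff)
    then show ?thesis
    proof
      assume "b = a + 1"
      then show ?thesis
        using rim_pair_in_stalled[of a] that 3(2) assms(2) by auto
    next
      assume "a = 1 \<and> b = n"
      then have "{a, b} \<subseteq> insert n {1..s}"
        using s_pos by auto
      moreover have "0 \<notin> insert n {1..s}"
        using n_ge by simp
      ultimately show ?thesis
        using that[OF stalled_first_segment] by blast
    qed
  qed
qed

section \<open>Minimality of three blue vertices\<close>

lemma gear_zero_forcing_set_card:
  assumes "zero_forcing_set G B"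
  shows "3 \<le> card B"
proof (rule ccontr)
  assume "\<not> 3 \<le> card B"
  have "B \<subseteq> {0..n}"
    using assms by (simp add: zero_forcing_set_def pverts_gear)
  \<comment> \<open>Padding \<open>B\<close> to exactly two vertices covers the empty set and
    singletons as well.\<close>
  then obtain D where D: "B \<subseteq> D" "D \<subseteq> {0..n}" "card D = 2"
    using exists_subset_between[of B 2 "{0..n}"] \<open>\<not> 3 \<le> card B\<close> n_ge by auto
  then obtain x y where "D = {x, y}" "x \<noteq> y"
    by (auto simp: card_2_iff)
  then obtain a b where ab: "D = {a, b}" "a < b"
    by (metis insert_commute linorder_neqE_nat)
  then obtain C where "stalled G C" "{a, b} \<subseteq> C" "\<exists>x\<le>n. x \<notin> C"
    using pair_in_stalled[of a b] D(2) by auto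
  then show False
    using stalled_not_zero_forcing[of G C B] assms D(1) ab(1) pverts_gear by auto
qed

lemma zero_forcing_number_gear: "zero_forcing_number G = 3"
proof -
  have "card {0, 1, n} = 3"
    using n_ge by simp
  then show ?thesis
    using zero_forcing_number_eqI[OF gear_zero_forcing_set] gear_zero_forcing_set_card by metis
qed

end

text \<open>The hypotheses exclude only degenerate cases with a value below 3: for
  \<open>m \<le> 1\<close> the hub has at most one neighbour, and \<open>m = 2\<close>,
  \<open>r = 0\<close> gives a triangle.\<close>

theorem theorem2p3:
  fixes m r :: nat
  assumes "m \<ge> 2" and "m * (r + 1) \<ge> 3"
  shows "zero_forcing_number (gear_graph m r) = 3"
proof -
  interpret gear m r "r + 1" "m * (r + 1)"
    using assms by unfold_locales simp_all
  show ?thesis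
    by (rule zero_forcing_number_gear)
qed

end
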